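(* Let $G=(V,E)$ be a directed graph with $n=|V|$, let $A$ be a node-weighting of $G$, and let $h>1$, $\alpha\ge 1$, $\phi<1$, and a length slack parameter $s=O(\log n)$ be given. Then there is a directed $(h,s)$-length $\phi$-expander decomposition for $A$ with cut slack $\kappa=O(n^{O(1/s)}\log n)$. That is, there is an $h\cdot s$-length moving cut $C$ of $G$ with $|C|\le \kappa\cdot\phi\cdot|A|$ such that $A$ is $(h,s)$-length $\phi$-expanding in $G-C$ (the $O(\cdot)$'s hide absolute constants).
   Context: Standing assumptions: $G=(V,E)$ is a finite directed graph; every edge $e$ has a length $\ell(e)$ and a capacity $u(e)$, both positive integers bounded by $N=\mathrm{poly}(n)$. For a directed path $P$, $\ell(P)=\sum_{e\in P}\ell(e)$; $\mathrm{dist}_G(v,w)$ is the minimum length of a directed $v\to w$ path ($\infty$ if none). A node-weighting is $A:V\to\mathbb{R}_{\ge0}$ with $|A|=\sum_v A(v)$. A demand is $D:V\times V\to\mathbb{R}_{\ge 0}$, $|D|=\sum_{v,w}D(v,w)$. $D$ is $A$-respecting if $\max\{\sum_w D(v,w),\sum_w D(w,v)\}\le A(v)$ for all $v$; $D$ is $h$-length (in $G$) if $D(v,w)>0$ implies $\mathrm{dist}_G(v,w)\le h$; $D$ is symmetric if $D(v,w)=D(w,v)$ for all $v,w$. For $H>0$, an $H$-length moving cut is a function $C:E\to\{0,\tfrac1H,\tfrac2H,\dots\}\cap[0,1]$; its size is $|C|=\sum_e u(e)C(e)$; $G-C$ denotes $G$ with each edge length increased to $\ell(e)+H\cdot C(e)$.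 For $h'>0$, $\mathrm{sep}_{h'}(C,D)=\sum_{(u,v):\,\mathrm{dist}_{G-C}(u,v)>h'}D(u,v)$, and when this is positive, $\mathrm{spars}_{h'}(C,D)=|C|/\mathrm{sep}_{h'}(C,D)$. For an $hs$-length moving cut $C$, $\mathrm{spars}_{(h,s)}(C,A)$ is the minimum of $\mathrm{spars}_{hs}(C,D)$ over all $A$-respecting $h$-length symmetric demands $D$ (demands with zero separation count as $+\infty$). The $(h,s)$-length conductance of $A$ in $G$ is the minimum of $\mathrm{spars}_{(h,s)}(C,A)$ over all $hs$-length moving cuts $C$ of $G$, and $A$ is $(h,s)$-length $\phi$-expanding in $G$ if this conductance is at least $\phi$ (all notions evaluated in the graph in question, e.g. in $G-C$ for expansion in $G-C$).
   Formalization: The formal theorem additionally assumes length slack s ≥ 1, φ > 0 and n ≥ 2; for s < 1 the claim fails (a 2-cycle with edge length in (hs, h] and tiny φ), and for φ < 0 the bound on |C| is impossible. *)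

theory Defs
  imports Complex_Main "HOL-Library.Extended_Real"
begin

text \<open>A directed graph is a finite vertex set V with an edge set E \<subseteq> V \<times> V.
  Edge lengths are given by a function L on edges (real-valued so that lengths
  of the graph G - C can be expressed), capacities by u.\<close>

definition is_walk :: "('a \<times> 'a) set \<Rightarrow> 'a \<Rightarrow> 'a \<Rightarrow> 'a list \<Rightarrow> bool" where
  "is_walk E v w xs \<longleftrightarrow> xs \<noteq> [] \<and> hd xs = v \<and> last xs = w \<and>
     (\<forall>i < length xs - 1. (xs ! i, xs ! Suc i) \<in> E)"

definition walk_len :: "('a \<times> 'a \<Rightarrow> real) \<Rightarrow> 'a list \<Rightarrow> real" where
  "walk_len L xs = (\<Sum>i < length xs - 1. L (xs ! i, xs ! Suc i))"

definition gdist :: "('a \<times> 'a) set \<Rightarrow> ('a \<times> 'a \<Rightarrow> real) \<Rightarrow> 'a \<Rightarrow> 'a \<Rightarrow> ereal" where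
  "gdist E L v w = Inf {ereal (walk_len L xs) | xs. is_walk E v w xs}"

definition moving_cut :: "('a \<times> 'a) set \<Rightarrow> real \<Rightarrow> ('a \<times> 'a \<Rightarrow> real) \<Rightarrow> bool" where
  "moving_cut E H C \<longleftrightarrow> (\<forall>e\<in>E. (\<exists>k::nat. C e = real k / H) \<and> 0 \<le> C e \<and> C e \<le> 1)"

definition cut_size :: "('a \<times> 'a) set \<Rightarrow> ('a \<times> 'a \<Rightarrow> real) \<Rightarrow> ('a \<times> 'a \<Rightarrow> real) \<Rightarrow> real" where
  "cut_size E u C = (\<Sum>e\<in>E. u e * C e)"

definition cut_len :: "('a \<times> 'a \<Rightarrow> real) \<Rightarrow> real \<Rightarrow> ('a \<times> 'a \<Rightarrow> real) \<Rightarrow> ('a \<times> 'a \<Rightarrow> real)" where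
  "cut_len L H C = (\<lambda>e. L e + H * C e)"

definition weight :: "'a set \<Rightarrow> ('a \<Rightarrow> real) \<Rightarrow> real" where
  "weight V A = (\<Sum>v\<in>V. A v)"

definition is_demand :: "'a set \<Rightarrow> ('a \<Rightarrow> 'a \<Rightarrow> real) \<Rightarrow> bool" where
  "is_demand V D \<longleftrightarrow> (\<forall>v w. 0 \<le> D v w \<and> (D v w \<noteq> 0 \<longrightarrow> v \<in> V \<and> w \<in> V))"

definition respecting :: "'a set \<Rightarrow> ('a \<Rightarrow> real) \<Rightarrow> ('a \<Rightarrow> 'a \<Rightarrow> real) \<Rightarrow> bool" where
  "respecting V A D \<longleftrightarrow>
     (\<forall>v\<in>V. max (\<Sum>w\<in>V. D v w) (\<Sum>w\<in>V. D w v) \<le> A v)"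

definition h_length :: "('a \<times> 'a) set \<Rightarrow> ('a \<times> 'a \<Rightarrow> real) \<Rightarrow> real \<Rightarrow> ('a \<Rightarrow> 'a \<Rightarrow> real) \<Rightarrow> bool" where
  "h_length E L h D \<longleftrightarrow> (\<forall>v w. D v w > 0 \<longrightarrow> gdist E L v w \<le> ereal h)"

definition symmetric_demand :: "('a \<Rightarrow> 'a \<Rightarrow> real) \<Rightarrow> bool" where
  "symmetric_demand D \<longleftrightarrow> (\<forall>v w. D v w = D w v)"

definition sep :: "'a set \<Rightarrow> ('a \<times> 'a) set \<Rightarrow> ('a \<times> 'a \<Rightarrow> real) \<Rightarrow> real \<Rightarrow>
    ('a \<times> 'a \<Rightarrow> real) \<Rightarrow> real \<Rightarrow> ('a \<Rightarrow> 'a \<Rightarrow> real) \<Rightarrow> real" where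
  "sep V E L H C h' D =
     (\<Sum>p\<in>V \<times> V. if gdist E (cut_len L H C) (fst p) (snd p) > ereal h' then D (fst p) (snd p) else 0)"

definition spars_hs :: "'a set \<Rightarrow> ('a \<times> 'a) set \<Rightarrow> ('a \<times> 'a \<Rightarrow> real) \<Rightarrow> ('a \<times> 'a \<Rightarrow> real) \<Rightarrow>
    real \<Rightarrow> real \<Rightarrow> ('a \<Rightarrow> real) \<Rightarrow> ('a \<times> 'a \<Rightarrow> real) \<Rightarrow> ereal" where
  "spars_hs V E L u h s A C =
     (INF D \<in> {D. is_demand V D \<and> respecting V A D \<and> h_length E L h D \<and> symmetric_demand D}.
        (if sep V E L (h * s) C (h * s) D > 0
         then ereal (cut_size E u C / sep V E L (h * s) C (h * s) D) else \<infinity>))"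

definition conductance :: "'a set \<Rightarrow> ('a \<times> 'a) set \<Rightarrow> ('a \<times> 'a \<Rightarrow> real) \<Rightarrow> ('a \<times> 'a \<Rightarrow> real) \<Rightarrow>
    real \<Rightarrow> real \<Rightarrow> ('a \<Rightarrow> real) \<Rightarrow> ereal" where
  "conductance V E L u h s A =
     (INF C \<in> {C. moving_cut E (h * s) C}. spars_hs V E L u h s A C)"

definition expanding :: "'a set \<Rightarrow> ('a \<times> 'a) set \<Rightarrow> ('a \<times> 'a \<Rightarrow> real) \<Rightarrow> ('a \<times> 'a \<Rightarrow> real) \<Rightarrow>
    real \<Rightarrow> real \<Rightarrow> ('a \<Rightarrow> real) \<Rightarrow> real \<Rightarrow> bool" where
  "expanding V E L u h s A \<phi> \<longleftrightarrow> conductance V E L u h s A \<ge> ereal \<phi>"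

end

theory Submission
  imports Defs
begin

text \<open>Write \<open>B\<^sub>j(v)\<close> for the set of vertices whose distances to and from \<open>v\<close> are both at most
  \<open>j h\<close>, and let \<open>\<Phi> = \<Sum>\<^sub>v A(v) \<Sum>\<^sub>j ln |B\<^sub>j(v)|\<close>, where \<open>j\<close> ranges over \<open>1..J\<close> and \<open>J \<approx> s/2\<close>.
  If a cut takes a pair \<open>v, w\<close> from mutual distance at most \<open>h\<close> to distance more than \<open>h s\<close>, then the
  new balls \<open>B'\<^sub>j(v)\<close> and \<open>B'\<^sub>j\<^sub>-\<^sub>1(w)\<close> are disjoint subsets of \<open>B\<^sub>j(v)\<close>, and the same holds with
  \<open>v, w\<close> exchanged. As the ball sizes lie between \<open>1\<close> and \<open>n\<close>, the AM-GM inequality over the \<open>J\<close>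
  scales shows that the inner sums for \<open>v\<close> and \<open>w\<close> together drop by at least \<open>J n\<^bsup>-1/J\<^esup> / 2\<close>. Hence the
  demand separated by a cut is at most \<open>4 n\<^bsup>1/J\<^esup> / J\<close> times the drop of \<open>\<Phi>\<close>, while initially
  \<open>\<Phi> \<le> |A| J ln n\<close>. Superimposing \<open>\<phi>\<close>-sparse cuts as long as there are any therefore costs at most
  \<open>4 n\<^bsup>1/J\<^esup> ln n \<phi> |A|\<close>.\<close>

subsection \<open>Walks and distances\<close>

lemma is_walk_singleton: "is_walk E v w [x] \<longleftrightarrow> v = x \<and> w = x"
  by (auto simp: is_walk_def)

lemma is_walk_Cons_Cons:
  "is_walk E v w (x # y # xs) \<longleftrightarrow> v = x \<and> (x, y) \<in> E \<and> is_walk E y w (y # xs)"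
  by (auto simp: is_walk_def less_Suc_eq_0_disj)

lemma walk_len_singleton [simp]: "walk_len L [x] = 0"
  by (simp add: walk_len_def)

lemma walk_len_Cons_Cons [simp]: "walk_len L (x # y # xs) = L (x, y) + walk_len L (y # xs)"
  by (simp add: walk_len_def sum.lessThan_Suc_shift del: sum.lessThan_Suc)

lemma is_walk_append:
  assumes "is_walk E u v xs" "is_walk E v w ys"
  shows "is_walk E u w (xs @ tl ys) \<and> walk_len L (xs @ tl ys) = walk_len L xs + walk_len L ys"
  using assms(1)
proof (induction xs arbitrary: u rule: induct_list012)
  case 1
  then show ?case by (simp add: is_walk_def)
next
  case (2 x)
  then have "u = x" "v = x" by (auto simp: is_walk_singleton)
  moreover have "ys \<noteq> []" "hd ys = v" using assms(2) by (auto simp: is_walk_def)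
  then have "v # tl ys = ys" by (cases ys) auto
  ultimately show ?case using assms(2) by simp
next
  case (3 x y zs)
  then show ?case by (auto simp: is_walk_Cons_Cons)
qed

lemma walk_len_mono:
  assumes "\<And>e. e \<in> E \<Longrightarrow> L e \<le> L' e" "is_walk E v w xs"
  shows "walk_len L xs \<le> walk_len L' xs"
  unfolding walk_len_def using assms by (intro sum_mono) (auto simp: is_walk_def)

lemma gdist_le_walk_len: "is_walk E v w xs \<Longrightarrow> gdist E L v w \<le> ereal (walk_len L xs)"
  unfolding gdist_def by (rule Inf_lower) auto

lemma gdist_less_obtain_walk:
  assumes "gdist E L v w < ereal r"
  obtains xs where "is_walk E v w xs" "walk_len L xs < r"
  using assms unfolding gdist_def Inf_less_iff by auto

lemma gdist_refl: "gdist E L v v \<le> 0"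
  using gdist_le_walk_len[of E v v "[v]" L] by (simp add: is_walk_singleton zero_ereal_def)

lemma gdist_mono:
  assumes "\<And>e. e \<in> E \<Longrightarrow> L e \<le> L' e"
  shows "gdist E L v w \<le> gdist E L' v w"
proof -
  have "gdist E L v w \<le> ereal (walk_len L' xs)" if "is_walk E v w xs" for xs
    using gdist_le_walk_len[OF that, of L] walk_len_mono[OF assms that]
    by (meson ereal_less_eq(3) order_trans)
  then show ?thesis
    unfolding gdist_def[of E L'] by (auto intro!: Inf_greatest)
qed

lemma gdist_triangle:
  assumes "gdist E L u v \<le> ereal a" "gdist E L v w \<le> ereal b"
  shows "gdist E L u w \<le> ereal (a + b)"
\<comment> \<open>For an arbitrary real \<open>L\<close> the infimum over walks need not be
  attained, so near-optimal walks with slack \<open>e / 2\<close> each are joined.\<close>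
proof (rule ereal_le_epsilon2)
  fix e :: real
  assume e: "0 < e"
  have "gdist E L u v < ereal (a + e / 2)" "gdist E L v w < ereal (b + e / 2)"
    using assms e by (auto elim!: le_less_trans)
  then obtain xs ys where xs: "is_walk E u v xs" "walk_len L xs < a + e / 2"
    and ys: "is_walk E v w ys" "walk_len L ys < b + e / 2"
    by (meson gdist_less_obtain_walk)
  have "gdist E L u w \<le> ereal (walk_len L xs + walk_len L ys)"
    using gdist_le_walk_len[of E u w "xs @ tl ys" L] is_walk_append[OF xs(1) ys(1), of L] by simp
  also have "\<dots> \<le> ereal (a + b) + ereal e"
    using xs(2) ys(2) by simp
  finally show "gdist E L u w \<le> ereal (a + b) + ereal e" .
qed

text \<open>As \<open>L'\<close> is nonnegative, a walk of \<open>L'\<close>-length below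
  \<open>K\<close> uses only edges with \<open>L' e < K\<close>, where \<open>L\<close> is no
  larger. This allows \<open>L'\<close> to be capped at large values.\<close>

lemma gdist_truncate:
  assumes short: "\<And>e. e \<in> E \<Longrightarrow> L' e < K \<Longrightarrow> L e \<le> L' e"
    and nonneg: "\<And>e. e \<in> E \<Longrightarrow> 0 \<le> L' e"
    and less: "gdist E L' v w < ereal K"
  shows "gdist E L v w \<le> gdist E L' v w"
proof -
  have *: "gdist E L v w \<le> ereal (walk_len L' xs)"
    if xs: "is_walk E v w xs" "walk_len L' xs < K" for xs
  proof -
    have "L (xs ! i, xs ! Suc i) \<le> L' (xs ! i, xs ! Suc i)" if i: "i < length xs - 1" for i
    proof -
      have E: "(xs ! j, xs ! Suc j) \<in> E" if "j < length xs - 1" for j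
        using xs(1) that by (auto simp: is_walk_def)
      have "L' (xs ! i, xs ! Suc i) \<le> walk_len L' xs"
        unfolding walk_len_def using i E nonneg
        by (intro member_le_sum[of i _ "\<lambda>i. L' (xs ! i, xs ! Suc i)"]) auto
      then show ?thesis using short[OF E[OF i]] xs(2) by simp
    qed
    then have "walk_len L xs \<le> walk_len L' xs"
      unfolding walk_len_def by (intro sum_mono) auto
    then show ?thesis using gdist_le_walk_len[OF xs(1), of L] by (simp add: order_trans)
  qed
  \<comment> \<open>Walks of \<open>L'\<close>-length at least \<open>K\<close> are handled by
    comparison with this shorter one.\<close>
  obtain ys where ys: "is_walk E v w ys" "walk_len L' ys < K"
    using gdist_less_obtain_walk[OF less] .
  have "gdist E L v w \<le> ereal (walk_len L' xs)" if "is_walk E v w xs" for xs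
  proof (cases "walk_len L' xs < K")
    case False
    then have "ereal (walk_len L' ys) \<le> ereal (walk_len L' xs)" using ys(2) by simp
    then show ?thesis using *[OF ys] by (rule order_trans[rotated])
  qed (use * that in auto)
  then show ?thesis
    unfolding gdist_def[of E L'] by (auto intro!: Inf_greatest)
qed

subsection \<open>Balls of the symmetrised distance\<close>

text \<open>Both directions are required because demands are symmetric: the endpoints of an
  \<open>h\<close>-length demand pair lie in each other's balls of radius \<open>h\<close>.\<close>

definition sym_ball :: "'a set \<Rightarrow> ('a \<times> 'a) set \<Rightarrow> ('a \<times> 'a \<Rightarrow> real) \<Rightarrow> real \<Rightarrow> 'a \<Rightarrow> 'a set" where
  "sym_ball V E L r v = {w \<in> V. gdist E L v w \<le> ereal r \<and> gdist E L w v \<le> ereal r}"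

lemma finite_sym_ball: "finite V \<Longrightarrow> finite (sym_ball V E L r v)"
  by (simp add: sym_ball_def)

lemma centre_in_sym_ball: "v \<in> V \<Longrightarrow> 0 \<le> r \<Longrightarrow> v \<in> sym_ball V E L r v"
  using gdist_refl[of E L v] by (auto simp: sym_ball_def intro: order_trans)

lemma sym_ball_antimono:
  assumes "\<And>e. e \<in> E \<Longrightarrow> L e \<le> L' e"
  shows "sym_ball V E L' r v \<subseteq> sym_ball V E L r v"
  unfolding sym_ball_def using gdist_mono[of E L L', OF assms] by (auto intro: order_trans)

lemma sym_ball_mono: "r \<le> r' \<Longrightarrow> sym_ball V E L r v \<subseteq> sym_ball V E L r' v"
  unfolding sym_ball_def by (auto intro: order_trans)

lemma sym_ball_trans:
  assumes "v \<in> sym_ball V E L a u" "w \<in> sym_ball V E L b v"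
  shows "w \<in> sym_ball V E L (a + b) u"
  using assms gdist_triangle[of E L u v a w b] gdist_triangle[of E L w v b u a]
  by (auto simp: sym_ball_def add.commute)

lemma sym_ball_sym: "v \<in> V \<Longrightarrow> w \<in> sym_ball V E L r v \<Longrightarrow> v \<in> sym_ball V E L r w"
  by (auto simp: sym_ball_def)

lemma card_sym_ball_bounds:
  assumes "finite V" "v \<in> V" "0 \<le> r"
  shows "1 \<le> card (sym_ball V E L r v)" "card (sym_ball V E L r v) \<le> card V"
proof -
  show "1 \<le> card (sym_ball V E L r v)"
    using centre_in_sym_ball[OF assms(2,3), of E L] finite_sym_ball[OF assms(1), of E L r v]
    by (auto simp: Suc_le_eq card_gt_0_iff)
  show "card (sym_ball V E L r v) \<le> card V"
    using assms(1) by (auto intro!: card_mono simp: sym_ball_def)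
qed

text \<open>A common point of the two new balls would put \<open>w\<close> within
  \<open>2 * r + h\<close> of \<open>v\<close>, so they are disjoint. Both lie in the old ball,
  because \<open>w\<close> was within \<open>h\<close> of \<open>v\<close> and lengths only
  grow.\<close>

lemma card_sym_ball_separated:
  assumes "finite V" "v \<in> V"
    and le: "\<And>e. e \<in> E \<Longrightarrow> L e \<le> L' e"
    and near: "w \<in> sym_ball V E L h v"
    and far: "w \<notin> sym_ball V E L' H v"
    and "2 * r + h \<le> H"
  shows "card (sym_ball V E L' (r + h) v) + card (sym_ball V E L' r w)
    \<le> card (sym_ball V E L (r + h) v)"
proof -
  have w: "w \<in> V" using near by (simp add: sym_ball_def)
  have "x \<notin> sym_ball V E L' r w" if x: "x \<in> sym_ball V E L' (r + h) v" for x
  proof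
    assume "x \<in> sym_ball V E L' r w"
    then have "w \<in> sym_ball V E L' (r + h + r) v"
      using x sym_ball_sym[OF w] sym_ball_trans by fast
    then show False
      using far sym_ball_mono[of "r + h + r" H V E L' v] assms(6) by auto
  qed
  then have disj: "sym_ball V E L' (r + h) v \<inter> sym_ball V E L' r w = {}" by auto
  have "sym_ball V E L' r w \<subseteq> sym_ball V E L (r + h) v"
    using sym_ball_antimono[of E L L' V r w, OF le] sym_ball_trans[OF near] by (force simp: add.commute)
  then have "sym_ball V E L' (r + h) v \<union> sym_ball V E L' r w \<subseteq> sym_ball V E L (r + h) v"
    using sym_ball_antimono[of E L L' V "r + h" v, OF le] by auto
  from card_mono[OF finite_sym_ball[OF assms(1)] this] show ?thesis
    by (simp add: card_Un_disjoint[OF finite_sym_ball finite_sym_ball disj] assms(1))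
qed

subsection \<open>The potential\<close>

text \<open>AM-GM in exponential form: each term is bounded below by the tangent of
  \<open>exp\<close> at \<open>m\<close>.\<close>

lemma sum_exp_ge:
  fixes \<tau> :: "nat \<Rightarrow> real"
  assumes "real J * m \<le> (\<Sum>j<J. \<tau> j)"
  shows "real J * exp m \<le> (\<Sum>j<J. exp (\<tau> j))"
proof -
  have "real J * exp m \<le> exp m * (real J + ((\<Sum>j<J. \<tau> j) - real J * m))"
    using assms by (simp add: algebra_simps)
  also have "\<dots> = (\<Sum>j<J. exp m * (1 + (\<tau> j - m)))"
    by (simp add: sum_distrib_left[symmetric] sum.distrib sum_subtractf)
  also have "\<dots> \<le> (\<Sum>j<J. exp m * exp (\<tau> j - m))"
    by (intro sum_mono mult_left_mono exp_ge_add_one_self) auto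
  also have "\<dots> = (\<Sum>j<J. exp (\<tau> j))"
    by (simp add: mult_exp_exp)
  finally show ?thesis .
qed

text \<open>With \<open>x = a / b'\<close> and \<open>y = b / a'\<close>, the two growth ratios are
  at least \<open>1 + y\<close> and \<open>1 + x\<close>, and their product is at least
  \<open>1 + x + y\<close>. This exceeds \<open>1 + t\<close> for the geometric mean
  \<open>t\<close> of \<open>x\<close> and \<open>y\<close>.\<close>

lemma ln_growth_pair:
  fixes a a' b b' p q :: real
  assumes "0 < a" "a \<le> a'" "0 < b" "b \<le> b'" "a' + b \<le> p" "b' + a \<le> q"
  shows "exp ((ln a - ln a' + ln b - ln b') / 2) / 2 \<le> (ln p - ln a') + (ln q - ln b')"
proof -
  define t where "t = exp ((ln a - ln a' + ln b - ln b') / 2)"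
  have pos: "0 < a'" "0 < b'" "0 < p" "0 < q" using assms by auto
  have "t\<^sup>2 = exp (ln a - ln a' + ln b - ln b')"
    unfolding t_def by (simp add: power2_eq_square flip: exp_add)
  also have "\<dots> = (a / a') * (b / b')"
    using assms pos by (simp add: exp_add exp_diff)
  \<comment> \<open>Exchanging the denominators links the two sides: the ratios
    \<open>a / a'\<close> and \<open>b / b'\<close> telescope over the scales, while
    \<open>a / b'\<close> and \<open>b / a'\<close> govern the growth.\<close>
  finally have t2: "t\<^sup>2 = (a / b') * (b / a')" by simp
  have "ln a \<le> ln a'" "ln b \<le> ln b'" using assms by (auto intro!: ln_mono)
  then have t: "0 < t" "t \<le> 1" by (auto simp: t_def)
  define x y where "x = a / b'" and "y = b / a'"
  have xy: "0 < x" "0 < y" "t\<^sup>2 = x * y"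
    using assms pos t2 by (simp_all add: x_def y_def)
  have "x * y \<le> (x + y)\<^sup>2" using xy(1,2) by (simp add: power2_sum)
  then have "t\<^sup>2 \<le> (x + y)\<^sup>2" unfolding xy(3) .
  then have "t \<le> x + y" by (rule power2_le_imp_le) (use xy in simp)
  moreover have "(1 + x) * (1 + y) = 1 + (x + y) + x * y" by (simp add: algebra_simps)
  moreover have "0 < x * y" using xy by simp
  ultimately have "1 + t \<le> (1 + x) * (1 + y)" by linarith
  then have "ln (1 + t) \<le> ln ((1 + x) * (1 + y))" using t by (intro ln_mono) auto
  then have l1: "ln (1 + t) \<le> ln (1 + x) + ln (1 + y)" using xy by (simp add: ln_mult)
  have "1 + y \<le> p / a'" "1 + x \<le> q / b'"
    using divide_right_mono[OF assms(5), of a'] divide_right_mono[OF assms(6), of b'] pos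
    by (simp_all add: x_def y_def add_divide_distrib)
  then have "ln (1 + y) \<le> ln (p / a')" "ln (1 + x) \<le> ln (q / b')"
    using xy by (auto intro!: ln_mono)
  then have l2: "ln (1 + y) \<le> ln p - ln a'" "ln (1 + x) \<le> ln q - ln b'"
    using pos by (auto simp: ln_div)
  \<comment> \<open>Here \<open>t \<le> 1\<close> is essential; it turns \<open>ln (1 + t)\<close>
    into the linear bound \<open>t / 2\<close>.\<close>
  have "t / 2 \<le> t / (1 + t)" using t by (intro divide_left_mono) auto
  also have "\<dots> = 1 - 1 / (1 + t)" using t by (simp add: diff_divide_eq_iff)
  also have "\<dots> \<le> ln (1 + t)" using ln_le_minus_one[of "1 / (1 + t)"] t by (simp add: ln_div)
  finally show ?thesis using l1 l2 by (simp add: t_def)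
qed

text \<open>In the application \<open>a\<close>, \<open>b\<close> are ball sizes after the cut and
  \<open>p\<close>, \<open>q\<close> those before. The exponents of the single-scale bounds
  telescope, so their mean is at least \<open>- ln n / J\<close>, and AM-GM gives the power of
  \<open>n\<close>.\<close>

lemma sum_ln_growth_pair:
  fixes a b p q :: "nat \<Rightarrow> real"
  assumes "1 \<le> n" "1 \<le> J" "1 \<le> a 0" "1 \<le> b 0" "a J \<le> n" "b J \<le> n"
    and mono: "\<And>j. a j \<le> a (Suc j)" "\<And>j. b j \<le> b (Suc j)"
    and grow: "\<And>j. j < J \<Longrightarrow> a (Suc j) + b j \<le> p (Suc j)"
      "\<And>j. j < J \<Longrightarrow> b (Suc j) + a j \<le> q (Suc j)"
  shows "real J / 2 * n powr (- 1 / real J)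
    \<le> (\<Sum>j<J. ln (p (Suc j)) - ln (a (Suc j))) + (\<Sum>j<J. ln (q (Suc j)) - ln (b (Suc j)))"
proof -
  have a1: "1 \<le> a j" for j using order_trans[OF assms(3) lift_Suc_mono_le[of a 0, OF mono(1)]] by simp
  have b1: "1 \<le> b j" for j using order_trans[OF assms(4) lift_Suc_mono_le[of b 0, OF mono(2)]] by simp
  define \<tau> where "\<tau> j = (ln (a j) - ln (a (Suc j)) + ln (b j) - ln (b (Suc j))) / 2" for j
  have "(\<Sum>j<J. \<tau> j) =
      ((\<Sum>j<J. ln (a j) - ln (a (Suc j))) + (\<Sum>j<J. ln (b j) - ln (b (Suc j)))) / 2"
    by (simp add: \<tau>_def sum.distrib[symmetric] sum_divide_distrib[symmetric] algebra_simps)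
  also have "\<dots> = (ln (a 0) - ln (a J) + (ln (b 0) - ln (b J))) / 2"
    using sum_lessThan_telescope'[of "\<lambda>j. ln (a j)" J] sum_lessThan_telescope'[of "\<lambda>j. ln (b j)" J]
    by simp
  \<comment> \<open>Each of the two telescoped differences is at least \<open>- ln n\<close>, and
    their sum is halved.\<close>
  also have "\<dots> \<ge> - ln n"
  proof -
    have "ln (a J) \<le> ln n" "ln (b J) \<le> ln n" "0 \<le> ln (a 0)" "0 \<le> ln (b 0)"
      using assms(3-6) a1[of J] b1[of J] by (auto intro!: ln_mono)
    then show ?thesis by simp
  qed
  finally have "real J * (- ln n / real J) \<le> (\<Sum>j<J. \<tau> j)" using assms(2) by simp
  from sum_exp_ge[OF this] have "real J * n powr (- 1 / real J) \<le> (\<Sum>j<J. exp (\<tau> j))"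
    using assms(1) by (simp add: powr_def)
  then have "real J / 2 * n powr (- 1 / real J) \<le> (\<Sum>j<J. exp (\<tau> j) / 2)"
    by (simp add: sum_divide_distrib[symmetric])
  also have "\<dots> \<le> (\<Sum>j<J. (ln (p (Suc j)) - ln (a (Suc j))) + (ln (q (Suc j)) - ln (b (Suc j))))"
  proof (rule sum_mono)
    fix j assume "j \<in> {..<J}"
    then show "exp (\<tau> j) / 2
        \<le> (ln (p (Suc j)) - ln (a (Suc j))) + (ln (q (Suc j)) - ln (b (Suc j)))"
      unfolding \<tau>_def using a1[of j] b1[of j] mono[of j] grow[of j]
      by (intro ln_growth_pair) simp_all
  qed
  finally show ?thesis by (simp add: sum.distrib)
qed

section \<open>Logarithmic ball growth and the drop of the potential\<close>

definition log_growth ::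
    "'a set \<Rightarrow> ('a \<times> 'a) set \<Rightarrow> ('a \<times> 'a \<Rightarrow> real) \<Rightarrow> real \<Rightarrow> nat \<Rightarrow> 'a \<Rightarrow> real" where
  "log_growth V E L h J v = (\<Sum>j<J. ln (real (card (sym_ball V E L (real (Suc j) * h) v))))"

lemma log_growth_bounds:
  assumes "finite V" "v \<in> V" "0 \<le> h"
  shows "0 \<le> log_growth V E L h J v" "log_growth V E L h J v \<le> real J * ln (real (card V))"
proof -
  have b: "1 \<le> card (sym_ball V E L (real (Suc j) * h) v)"
    "card (sym_ball V E L (real (Suc j) * h) v) \<le> card V" for j
    using card_sym_ball_bounds[OF assms(1,2), of "real (Suc j) * h"] assms(3) by auto
  show "0 \<le> log_growth V E L h J v"
    unfolding log_growth_def using b by (intro sum_nonneg ln_ge_zero) (simp del: of_nat_Suc)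
  have "log_growth V E L h J v \<le> (\<Sum>j<J. ln (real (card V)))"
    unfolding log_growth_def using b
    by (intro sum_mono ln_mono) (auto simp del: of_nat_Suc simp: Suc_le_eq)
  then show "log_growth V E L h J v \<le> real J * ln (real (card V))" by simp
qed

lemma log_growth_antimono:
  assumes "finite V" "v \<in> V" "0 \<le> h" "\<And>e. e \<in> E \<Longrightarrow> L e \<le> L' e"
  shows "log_growth V E L' h J v \<le> log_growth V E L h J v"
proof -
  have "ln (real (card (sym_ball V E L' r v))) \<le> ln (real (card (sym_ball V E L r v)))"
    if "0 \<le> r" for r
    using card_sym_ball_bounds(1)[OF assms(1,2) that, of E L']
      card_mono[OF finite_sym_ball[OF assms(1)] sym_ball_antimono[of E L L' V r v, OF assms(4)]]
    by (intro ln_mono) auto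
  then show ?thesis
    unfolding log_growth_def using assms(3) by (intro sum_mono) simp
qed

text \<open>At scale \<open>j\<close> the balls of radius \<open>(j + 1) * h\<close> about one
  endpoint and \<open>j * h\<close> about the other are compared, in both roles. The largest scale
  \<open>J - 1\<close> explains the bound on \<open>(2 * real J - 1) * h\<close>.\<close>

lemma log_growth_separated:
  assumes "finite V" "v \<in> V" "w \<in> V" "0 \<le> h" "1 \<le> J"
    and le: "\<And>e. e \<in> E \<Longrightarrow> L e \<le> L' e"
    and near: "w \<in> sym_ball V E L h v"
    and far: "w \<notin> sym_ball V E L' H v"
    and J: "(2 * real J - 1) * h \<le> H"
  shows "real J / 2 * real (card V) powr (- 1 / real J)
    \<le> (log_growth V E L h J v - log_growth V E L' h J v)
      + (log_growth V E L h J w - log_growth V E L' h J w)"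
proof -
  define B where "B L j x = real (card (sym_ball V E L (real j * h) x))" for L j x
  have near': "v \<in> sym_ball V E L h w" and far': "v \<notin> sym_ball V E L' H w"
    using near far assms(2,3) sym_ball_sym by fast+
  have b: "1 \<le> B L' j x" "B L' j x \<le> card V" "B L' j x \<le> B L' (Suc j) x" if "x \<in> V" for j x
  proof -
    show "1 \<le> B L' j x" "B L' j x \<le> card V"
      using card_sym_ball_bounds[OF assms(1) that, of "real j * h" E L'] assms(4)
      by (auto simp: B_def)
    show "B L' j x \<le> B L' (Suc j) x"
      unfolding B_def using assms(1,4)
      by (intro of_nat_mono card_mono finite_sym_ball sym_ball_mono mult_right_mono) auto
  qed
  have rad: "2 * (real j * h) + h \<le> H" if "j < J" for j
  proof -
    have "(2 * real j + 1) * h \<le> (2 * real J - 1) * h"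
      using that assms(4) by (intro mult_right_mono) auto
    then show ?thesis using J by (simp add: algebra_simps)
  qed
  have grow: "B L' (Suc j) v + B L' j w \<le> B L (Suc j) v"
    "B L' (Suc j) w + B L' j v \<le> B L (Suc j) w" if "j < J" for j
    using card_sym_ball_separated[where L = L and L' = L', OF assms(1) assms(2) le near far rad[OF that]]
      card_sym_ball_separated[where L = L and L' = L', OF assms(1) assms(3) le near' far' rad[OF that]]
    unfolding B_def of_nat_add[symmetric] of_nat_le_iff
    by (simp_all add: algebra_simps)
  have "1 \<le> card V"
    using assms(1,2) by (auto simp: Suc_le_eq card_gt_0_iff)
  then have "real J / 2 * real (card V) powr (- 1 / real J) \<le>
      (\<Sum>j<J. ln (B L (Suc j) v) - ln (B L' (Suc j) v))
      + (\<Sum>j<J. ln (B L (Suc j) w) - ln (B L' (Suc j) w))"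
    using assms(2,3,5) b grow
    by (intro sum_ln_growth_pair[where a = "\<lambda>j. B L' j v" and b = "\<lambda>j. B L' j w"]) auto
  then show ?thesis
    by (simp only: log_growth_def B_def sum_subtractf)
qed

definition potential :: "'a set \<Rightarrow> ('a \<times> 'a) set \<Rightarrow> ('a \<times> 'a \<Rightarrow> real) \<Rightarrow> real \<Rightarrow> nat \<Rightarrow>
    ('a \<Rightarrow> real) \<Rightarrow> real" where
  "potential V E L h J A = (\<Sum>v\<in>V. A v * log_growth V E L h J v)"

lemma potential_bounds:
  assumes "finite V" "0 \<le> h" "\<And>v. v \<in> V \<Longrightarrow> 0 \<le> A v"
  shows "0 \<le> potential V E L h J A"
    "potential V E L h J A \<le> real J * ln (real (card V)) * weight V A"
proof -
  show "0 \<le> potential V E L h J A"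
    unfolding potential_def using assms log_growth_bounds(1)
    by (intro sum_nonneg mult_nonneg_nonneg) auto
  have "potential V E L h J A \<le> (\<Sum>v\<in>V. A v * (real J * ln (real (card V))))"
    unfolding potential_def using assms log_growth_bounds(2)
    by (intro sum_mono mult_left_mono) auto
  then show "potential V E L h J A \<le> real J * ln (real (card V)) * weight V A"
    by (simp add: weight_def sum_distrib_right[symmetric] mult.commute)
qed

text \<open>Each separated unit of demand is charged to the drops at both of its endpoints. A vertex
  is charged at most \<open>A v\<close> as a source and \<open>A v\<close> as a target, whence the
  factor 2.\<close>

lemma potential_drop:
  assumes "finite V" "0 \<le> h" "1 \<le> J"
    and le: "\<And>e. e \<in> E \<Longrightarrow> L e \<le> L' e"
    and J: "(2 * real J - 1) * h \<le> H"
    and D: "is_demand V D" "respecting V A D" "h_length E L h D" "symmetric_demand D"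
  shows "real J / 2 * real (card V) powr (- 1 / real J) *
      (\<Sum>p\<in>V \<times> V. if gdist E L' (fst p) (snd p) > ereal H then D (fst p) (snd p) else 0)
    \<le> 2 * (potential V E L h J A - potential V E L' h J A)"
proof -
  define c where "c = real J / 2 * real (card V) powr (- 1 / real J)"
  define \<Delta> where "\<Delta> v = log_growth V E L h J v - log_growth V E L' h J v" for v
  have \<Delta>: "0 \<le> \<Delta> v" if "v \<in> V" for v
    unfolding \<Delta>_def using log_growth_antimono[where L = L and L' = L', OF assms(1) that assms(2) le] by simp
  have D0: "0 \<le> D v w" for v w using D(1) by (simp add: is_demand_def)
  have pair: "c * (if gdist E L' v w > ereal H then D v w else 0) \<le> D v w * \<Delta> v + D v w * \<Delta> w"
    if "v \<in> V" "w \<in> V" for v w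
  proof (cases "gdist E L' v w > ereal H \<and> D v w > 0")
    case True
    then have "D w v > 0" using D(4) by (simp add: symmetric_demand_def)
    with True have "w \<in> sym_ball V E L h v" "w \<notin> sym_ball V E L' H v"
      using D(3) that by (auto simp: h_length_def sym_ball_def)
    from log_growth_separated[where L = L and L' = L', OF assms(1) that assms(2,3) le this J]
    have "c \<le> \<Delta> v + \<Delta> w" by (simp add: c_def \<Delta>_def)
    then have "c * D v w \<le> (\<Delta> v + \<Delta> w) * D v w" using D0 by (intro mult_right_mono)
    with True show ?thesis by (simp add: algebra_simps)
  next
    case False
    then have "gdist E L' v w > ereal H \<longrightarrow> D v w = 0" using D0[of v w] by auto
    then show ?thesis using D0[of v w] \<Delta> that by auto
  qed
  have out: "(\<Sum>w\<in>V. D v w) \<le> A v" and inn: "(\<Sum>w\<in>V. D w v) \<le> A v" if "v \<in> V" for v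
    using D(2) that by (auto simp: respecting_def)
  have "c * (\<Sum>p\<in>V \<times> V. if gdist E L' (fst p) (snd p) > ereal H then D (fst p) (snd p) else 0)
      = (\<Sum>v\<in>V. \<Sum>w\<in>V. c * (if gdist E L' v w > ereal H then D v w else 0))"
    by (simp add: sum_distrib_left sum.cartesian_product case_prod_beta)
  also have "\<dots> \<le> (\<Sum>v\<in>V. \<Sum>w\<in>V. D v w * \<Delta> v + D v w * \<Delta> w)"
    using pair by (intro sum_mono) auto
  also have "\<dots> = (\<Sum>v\<in>V. \<Sum>w\<in>V. D v w * \<Delta> v) + (\<Sum>v\<in>V. \<Sum>w\<in>V. D v w * \<Delta> w)"
    by (simp add: sum.distrib)
  \<comment> \<open>After the swap the drop at a target is weighted by its total incoming
    demand.\<close>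
  also have "(\<Sum>v\<in>V. \<Sum>w\<in>V. D v w * \<Delta> w) = (\<Sum>w\<in>V. \<Sum>v\<in>V. D v w * \<Delta> w)"
    by (rule sum.swap)
  also have "(\<Sum>v\<in>V. \<Sum>w\<in>V. D v w * \<Delta> v) + \<dots>
      = (\<Sum>v\<in>V. (\<Sum>w\<in>V. D v w) * \<Delta> v) + (\<Sum>v\<in>V. (\<Sum>w\<in>V. D w v) * \<Delta> v)"
    by (simp add: sum_distrib_right)
  also have "\<dots> \<le> (\<Sum>v\<in>V. A v * \<Delta> v) + (\<Sum>v\<in>V. A v * \<Delta> v)"
    using out inn \<Delta> by (intro add_mono sum_mono mult_right_mono) auto
  also have "\<dots> = 2 * (potential V E L h J A - potential V E L' h J A)"
    by (simp add: potential_def \<Delta>_def right_diff_distrib sum_subtractf)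
  finally show ?thesis by (simp add: c_def)
qed

subsection \<open>Superimposing moving cuts\<close>

text \<open>Truncating at \<open>\<lfloor>H\<rfloor> / H\<close> rather than at \<open>1\<close> stays in the grid of multiples of \<open>1 / H\<close>; as edge
  lengths are at least \<open>1\<close>, a truncated edge is still longer than \<open>H\<close>.\<close>

definition cut_add :: "real \<Rightarrow> ('b \<Rightarrow> real) \<Rightarrow> ('b \<Rightarrow> real) \<Rightarrow> 'b \<Rightarrow> real" where
  "cut_add H C C' e = min (C e + C' e) (of_int \<lfloor>H\<rfloor> / H)"

text \<open>The largest multiple of \<open>1 / H\<close> in the unit interval is
  \<open>\<lfloor>H\<rfloor> / H\<close>, so truncating there never lowers a moving cut.\<close>

lemma moving_cut_le_floor:
  assumes "0 < H" "moving_cut E H C" "e \<in> E"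
  shows "C e \<le> of_int \<lfloor>H\<rfloor> / H"
proof -
  obtain k :: nat where k: "C e = real k / H" "C e \<le> 1"
    using assms by (auto simp: moving_cut_def)
  then have "real k \<le> H" using assms(1) by (simp add: divide_le_eq)
  then have "int k \<le> \<lfloor>H\<rfloor>" by (simp add: le_floor_iff)
  then have "real k \<le> of_int \<lfloor>H\<rfloor>" by linarith
  then show ?thesis using k assms(1) by (simp add: divide_right_mono)
qed

lemma moving_cut_add:
  assumes "0 < H" "moving_cut E H C" "moving_cut E H C'"
  shows "moving_cut E H (cut_add H C C')"
  unfolding moving_cut_def
proof (intro ballI conjI)
  fix e assume e: "e \<in> E"
  obtain k k' :: nat where k: "C e = real k / H" "C' e = real k' / H"
    using assms e by (force simp: moving_cut_def)
  obtain m :: nat where m: "of_int \<lfloor>H\<rfloor> = real m"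
    using assms(1) by (metis of_nat_nat zero_le_floor less_imp_le of_int_of_nat_eq)
  have "cut_add H C C' e = real (min (k + k') m) / H"
    unfolding cut_add_def k m add_divide_distrib[symmetric]
    using assms(1) by (auto simp: min_def divide_le_cancel)
  then show "\<exists>k::nat. cut_add H C C' e = real k / H" "0 \<le> cut_add H C C' e"
    using assms(1) by auto
  have "of_int \<lfloor>H\<rfloor> / H \<le> 1" using assms(1) by simp
  then show "cut_add H C C' e \<le> 1" by (simp add: cut_add_def min_le_iff_disj)
qed

lemma cut_add_ge:
  assumes "0 < H" "moving_cut E H C" "moving_cut E H C'" "e \<in> E"
  shows "C e \<le> cut_add H C C' e"
  using moving_cut_le_floor[OF assms(1,2,4)] assms(3,4) by (auto simp: cut_add_def moving_cut_def)

lemma cut_size_add: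
  assumes "\<And>e. e \<in> E \<Longrightarrow> 0 \<le> u e"
  shows "cut_size E u (cut_add H C C') \<le> cut_size E u C + cut_size E u C'"
  unfolding cut_size_def sum.distrib[symmetric] using assms
  by (intro sum_mono) (auto simp: cut_add_def distrib_left[symmetric] intro!: mult_left_mono)

text \<open>A truncated edge has length at least \<open>1 + \<lfloor>H\<rfloor>\<close>, which is
  more than \<open>H\<close>; on all other edges the superposition is exact. Hence truncation
  creates no walk of length at most \<open>H\<close>.\<close>

lemma gdist_cut_add_separated:
  assumes "0 < H" "moving_cut E H C" "moving_cut E H C'"
    and l: "\<And>e. e \<in> E \<Longrightarrow> 1 \<le> L e"
    and far: "gdist E (cut_len (cut_len L H C) H C') v w > ereal H"
  shows "gdist E (cut_len L H (cut_add H C C')) v w > ereal H"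
proof (rule ccontr)
  assume "\<not> ?thesis"
  then have le: "gdist E (cut_len L H (cut_add H C C')) v w \<le> ereal H" by simp
  have "gdist E (cut_len (cut_len L H C) H C') v w \<le> gdist E (cut_len L H (cut_add H C C')) v w"
  proof (rule gdist_truncate)
    have "ereal H < ereal (1 + of_int \<lfloor>H\<rfloor>)" by simp linarith
    with le show "gdist E (cut_len L H (cut_add H C C')) v w < ereal (1 + of_int \<lfloor>H\<rfloor>)"
      by (rule le_less_trans)
  next
    fix e assume e: "e \<in> E" and short: "cut_len L H (cut_add H C C') e < 1 + of_int \<lfloor>H\<rfloor>"
    have "cut_add H C C' e \<noteq> of_int \<lfloor>H\<rfloor> / H"
    proof
      assume "cut_add H C C' e = of_int \<lfloor>H\<rfloor> / H"
      then have "H * cut_add H C C' e = of_int \<lfloor>H\<rfloor>" using assms(1) by simp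
      then show False using short l[OF e] by (simp add: cut_len_def)
    qed
    then have "cut_add H C C' e = C e + C' e" by (auto simp: cut_add_def min_def split: if_splits)
    then show "cut_len (cut_len L H C) H C' e \<le> cut_len L H (cut_add H C C') e"
      by (simp add: cut_len_def distrib_left)
  next
    fix e assume e: "e \<in> E"
    have "0 \<le> cut_add H C C' e"
      using moving_cut_add[OF assms(1-3)] e by (simp add: moving_cut_def)
    then show "0 \<le> cut_len L H (cut_add H C C') e"
      using l[OF e] assms(1) by (simp add: cut_len_def)
  qed
  then show False using le far by simp
qed

section \<open>From sparse cuts to an expander decomposition\<close>

lemma not_expandingE:
  assumes "\<not> expanding V E L u h s A \<phi>"
  obtains C D where "moving_cut E (h * s) C" "is_demand V D" "respecting V A D"
    "h_length E L h D" "symmetric_demand D" "0 < sep V E L (h * s) C (h * s) D"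
    "cut_size E u C < \<phi> * sep V E L (h * s) C (h * s) D"
proof -
  have "conductance V E L u h s A < ereal \<phi>"
    using assms by (simp add: expanding_def)
  then obtain C where C: "moving_cut E (h * s) C" "spars_hs V E L u h s A C < ereal \<phi>"
    by (auto simp: conductance_def INF_less_iff)
  then obtain D where D: "is_demand V D" "respecting V A D" "h_length E L h D" "symmetric_demand D"
    and less: "(if sep V E L (h * s) C (h * s) D > 0
         then ereal (cut_size E u C / sep V E L (h * s) C (h * s) D) else \<infinity>) < ereal \<phi>"
    unfolding spars_hs_def INF_less_iff by blast
  \<comment> \<open>The default \<open>\<infinity>\<close> excludes demands without
    separation.\<close>
  from less have "0 < sep V E L (h * s) C (h * s) D"
    by (auto split: if_splits)
  moreover from this less have "cut_size E u C < \<phi> * sep V E L (h * s) C (h * s) D"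
    by (simp add: divide_less_eq)
  ultimately show thesis using that C(1) D by blast
qed

text \<open>An extremal choice replaces the iteration: among cuts paid for by the drop of the
  potential, one with the fewest close pairs is taken. A further sparse cut could be superimposed,
  still paid for, and would destroy a close pair.\<close>

lemma exists_expander_decomposition:
  fixes L u :: "'a \<times> 'a \<Rightarrow> real"
  assumes "finite V" "1 < h" "1 \<le> s" "0 \<le> \<phi>" "1 \<le> J" "2 * real J - 1 \<le> s"
    and L: "\<And>e. e \<in> E \<Longrightarrow> 1 \<le> L e" and u: "\<And>e. e \<in> E \<Longrightarrow> 0 \<le> u e"
    and A: "\<And>v. v \<in> V \<Longrightarrow> 0 \<le> A v"
  shows "\<exists>C. moving_cut E (h * s) C \<and>
    real J / 2 * real (card V) powr (- 1 / real J) * cut_size E u C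
      \<le> 2 * \<phi> * (real J * ln (real (card V)) * weight V A) \<and>
    expanding V E (cut_len L (h * s) C) u h s A \<phi>"
proof -
  define H where "H = h * s"
  define c where "c = real J / 2 * real (card V) powr (- 1 / real J)"
  define \<Phi> where "\<Phi> C = potential V E (cut_len L H C) h J A" for C
  \<comment> \<open>The invariant: the cost so far is covered by the potential lost so far, with the
    factors \<open>c\<close> and 2 of \<open>potential_drop\<close>.\<close>
  define feasible where "feasible C \<longleftrightarrow> moving_cut E H C \<and>
    c * cut_size E u C \<le> 2 * \<phi> * (\<Phi> (\<lambda>_. 0) - \<Phi> C)" for C
  define close where "close C = {p \<in> V \<times> V. snd p \<in> sym_ball V E (cut_len L H C) h (fst p)}" for C
  have H: "0 < H" "h \<le> H" using assms(2,3) by (auto simp: H_def)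
  have c0: "0 \<le> c" by (simp add: c_def)
  have J: "(2 * real J - 1) * h \<le> H"
    unfolding H_def using assms(2,6) by (simp add: mult.commute)
  have "feasible (\<lambda>_. 0)"
    by (auto simp: feasible_def moving_cut_def cut_size_def intro: exI[of _ 0])
  then obtain C where C: "feasible C" and
    min: "\<And>C'. feasible C' \<Longrightarrow> card (close C) \<le> card (close C')"
    using ex_has_least_nat[of feasible _ "\<lambda>C. card (close C)"] by blast
  have mC: "moving_cut E H C" using C by (simp add: feasible_def)
  have "expanding V E (cut_len L H C) u h s A \<phi>"
  proof (rule ccontr)
    let ?L = "cut_len L H C"
    assume "\<not> ?thesis"
    then obtain C' D where C': "moving_cut E H C'"
      and D: "is_demand V D" "respecting V A D" "h_length E ?L h D" "symmetric_demand D"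
      and pos: "0 < sep V E ?L H C' H D"
      and sparse: "cut_size E u C' < \<phi> * sep V E ?L H C' H D"
      unfolding H_def by (rule not_expandingE)
    define C'' where "C'' = cut_add H C C'"
    let ?L'' = "cut_len L H C''"
    have D0: "0 \<le> D v w" for v w using D(1) by (simp add: is_demand_def)
    have le: "?L e \<le> ?L'' e" if "e \<in> E" for e
      using cut_add_ge[OF H(1) mC C' that] H(1) by (simp add: cut_len_def C''_def)
    have far: "gdist E ?L'' v w > ereal H" if "gdist E (cut_len ?L H C') v w > ereal H" for v w
      unfolding C''_def using gdist_cut_add_separated[OF H(1) mC C' L that] .
    \<comment> \<open>Pairs separated by applying \<open>C'\<close> after \<open>C\<close> stay
      separated under the truncated sum.\<close>
    have "sep V E ?L H C' H D \<le>
        (\<Sum>p\<in>V \<times> V. if gdist E ?L'' (fst p) (snd p) > ereal H then D (fst p) (snd p) else 0)"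
      unfolding sep_def using far D0 by (intro sum_mono) auto
    then have "c * sep V E ?L H C' H D \<le> c *
        (\<Sum>p\<in>V \<times> V. if gdist E ?L'' (fst p) (snd p) > ereal H then D (fst p) (snd p) else 0)"
      using c0 by (rule mult_left_mono)
    also have "\<dots> \<le> 2 * (\<Phi> C - \<Phi> C'')"
      unfolding c_def \<Phi>_def using assms(2)
      by (intro potential_drop[where L = ?L and L' = ?L'', OF assms(1) _ assms(5) le J D]) auto
    finally have drop: "c * sep V E ?L H C' H D \<le> 2 * (\<Phi> C - \<Phi> C'')" .
    \<comment> \<open>Sparsity bounds the new cost by \<open>\<phi>\<close> times the separated
      demand, which \<open>drop\<close> charges to the potential; the two potential differences then
      telescope.\<close>
    have "c * cut_size E u C'' \<le> c * (cut_size E u C + cut_size E u C')"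
      unfolding C''_def using cut_size_add[of E u] u c0 by (intro mult_left_mono) auto
    also have "\<dots> \<le> c * cut_size E u C + c * (\<phi> * sep V E ?L H C' H D)"
      using sparse c0 by (simp add: distrib_left mult_left_mono)
    also have "\<dots> = c * cut_size E u C + \<phi> * (c * sep V E ?L H C' H D)" by simp
    also have "\<dots> \<le> 2 * \<phi> * (\<Phi> (\<lambda>_. 0) - \<Phi> C) + \<phi> * (2 * (\<Phi> C - \<Phi> C''))"
      using C drop assms(4) by (intro add_mono mult_left_mono) (auto simp: feasible_def)
    also have "\<dots> = 2 * \<phi> * (\<Phi> (\<lambda>_. 0) - \<Phi> C'')" by (simp add: algebra_simps)
    finally have "feasible C''"
      using moving_cut_add[OF H(1) mC C'] by (simp add: feasible_def C''_def)
    then have "card (close C) \<le> card (close C'')" by (rule min)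
    moreover have "close C'' \<subset> close C"
    proof
      show "close C'' \<subseteq> close C"
        unfolding close_def using sym_ball_antimono[of E ?L ?L'' V h, OF le] by auto
      have "\<exists>p\<in>V \<times> V. gdist E (cut_len ?L H C') (fst p) (snd p) > ereal H \<and> D (fst p) (snd p) \<noteq> 0"
      proof (rule ccontr)
        assume "\<not> ?thesis"
        then have "sep V E ?L H C' H D = 0"
          unfolding sep_def by (intro sum.neutral) auto
        then show False using pos by simp
      qed
      then obtain v w where vw: "v \<in> V" "w \<in> V" "gdist E (cut_len ?L H C') v w > ereal H" "D v w \<noteq> 0"
        by auto
      then have "D v w > 0" "D w v > 0"
        using D0[of v w] D(4) by (auto simp: symmetric_demand_def less_le)
      then have "(v, w) \<in> close C"
        using D(3) vw by (auto simp: close_def sym_ball_def h_length_def)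
      \<comment> \<open>A separated demand pair was close and is now farther than \<open>H\<close>,
        hence than \<open>h\<close>.\<close>
      moreover have "ereal h < gdist E ?L'' v w"
        using far[OF vw(3)] H(2) by (meson ereal_less_eq(3) le_less_trans)
      then have "(v, w) \<notin> close C''"
        by (auto simp: close_def sym_ball_def)
      ultimately show "close C'' \<noteq> close C" by blast
    qed
    then have "card (close C'') < card (close C)"
      using assms(1) by (intro psubset_card_mono) (auto simp: close_def)
    ultimately show False by simp
  qed
  moreover have "c * cut_size E u C \<le> 2 * \<phi> * (real J * ln (real (card V)) * weight V A)"
  proof -
    \<comment> \<open>The initial potential obeys the upper bound and the final one is
      nonnegative.\<close>
    have "\<Phi> (\<lambda>_. 0) - \<Phi> C \<le> real J * ln (real (card V)) * weight V A"
      using potential_bounds[where A = A and h = h, OF assms(1) _ A] assms(2)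
      unfolding \<Phi>_def by (smt (verit))
    then have "2 * \<phi> * (\<Phi> (\<lambda>_. 0) - \<Phi> C) \<le> 2 * \<phi> * (real J * ln (real (card V)) * weight V A)"
      using assms(4) by (intro mult_left_mono) auto
    then show ?thesis using C by (simp add: feasible_def)
  qed
  ultimately show ?thesis using mC by (auto simp: H_def c_def)
qed

text \<open>The largest \<open>J\<close> with \<open>2 * real J - 1 \<le> s\<close> works: then
  \<open>s < 2 * real J + 1\<close>, which is at most \<open>3 * real J\<close> because
  \<open>J\<close> is at least 1.\<close>

lemma exists_scale_count:
  fixes s :: real
  assumes "1 \<le> s"
  obtains J :: nat where "1 \<le> J" "2 * real J - 1 \<le> s" "s \<le> 3 * real J"
proof
  define k where "k = \<lfloor>(s + 1) / 2\<rfloor>"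
  have k: "1 \<le> k" using assms by (simp add: k_def le_floor_iff)
  then show "1 \<le> nat k" by simp
  have eq: "real (nat k) = of_int k" and "1 \<le> real_of_int k" using k by simp_all
  have "of_int k \<le> (s + 1) / 2" "(s + 1) / 2 < of_int k + 1"
    using floor_correct[of "(s + 1) / 2"] by (simp_all only: k_def of_int_add of_int_1)
  with \<open>1 \<le> real_of_int k\<close> show "2 * real (nat k) - 1 \<le> s" "s \<le> 3 * real (nat k)"
    unfolding eq by argo+
qed

theorem theorem3p9:
  "\<forall>cN c0 :: real. \<exists>c1 c2 :: real. c1 > 0 \<and> c2 > 0 \<and>
    (\<forall>(V :: 'a set) E (l :: 'a \<times> 'a \<Rightarrow> nat) (u :: 'a \<times> 'a \<Rightarrow> nat) A h (\<alpha> :: real) \<phi> s.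
      finite V \<and> E \<subseteq> V \<times> V \<and> card V \<ge> 2 \<and>
      (\<forall>e\<in>E. 1 \<le> l e \<and> real (l e) \<le> real (card V) powr cN \<and>
              1 \<le> u e \<and> real (u e) \<le> real (card V) powr cN) \<and>
      (\<forall>v\<in>V. 0 \<le> A v) \<and>
      h > 1 \<and> \<alpha> \<ge> 1 \<and> 0 < \<phi> \<and> \<phi> < 1 \<and> 1 \<le> s \<and> s \<le> c0 * ln (real (card V))
      \<longrightarrow>
      (\<exists>C. moving_cut E (h * s) C \<and>
           cut_size E (\<lambda>e. real (u e)) C
             \<le> (c1 * real (card V) powr (c2 / s) * ln (real (card V))) * \<phi> * weight V A \<and>
           expanding V E (cut_len (\<lambda>e. real (l e)) (h * s) C) (\<lambda>e. real (u e)) h s A \<phi>))"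
proof (intro allI, rule exI[of _ 4], rule exI[of _ 3], (intro conjI allI impI; (elim conjE)?))
  fix V :: "'a set" and E and l u :: "'a \<times> 'a \<Rightarrow> nat" and A :: "'a \<Rightarrow> real" and h \<phi> s c0 cN :: real
  assume V: "finite V" "2 \<le> card V"
    and lu: "\<forall>e\<in>E. 1 \<le> l e \<and> real (l e) \<le> real (card V) powr cN \<and>
              1 \<le> u e \<and> real (u e) \<le> real (card V) powr cN"
    and A: "\<forall>v\<in>V. 0 \<le> A v" and h: "h > 1" and \<phi>: "0 < \<phi>" and s: "1 \<le> s"
  obtain J :: nat where J: "1 \<le> J" "2 * real J - 1 \<le> s" "s \<le> 3 * real J"
    using exists_scale_count[OF s] .
  obtain C where C: "moving_cut E (h * s) C"
    "real J / 2 * real (card V) powr (- 1 / real J) * cut_size E (\<lambda>e. real (u e)) C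
      \<le> 2 * \<phi> * (real J * ln (real (card V)) * weight V A)"
    "expanding V E (cut_len (\<lambda>e. real (l e)) (h * s) C) (\<lambda>e. real (u e)) h s A \<phi>"
    using exists_expander_decomposition[of V h s \<phi> J E "\<lambda>e. real (l e)" "\<lambda>e. real (u e)" A] V lu A h \<phi> s J by auto
  define n where "n = real (card V)"
  have n: "1 < n" using V by (simp add: n_def)
  have W: "0 \<le> weight V A" using A by (simp add: weight_def sum_nonneg)
  \<comment> \<open>The constant 4 is the 2 on the right divided by the \<open>1 / 2\<close> on the
    left.\<close>
  have "real J * (n powr (- 1 / real J) * cut_size E (\<lambda>e. real (u e)) C) \<le> real J * (4 * \<phi> * (ln n * weight V A))"
    using C(2) by (simp add: n_def field_simps)
  then have "n powr (- 1 / real J) * cut_size E (\<lambda>e. real (u e)) C \<le> 4 * \<phi> * (ln n * weight V A)"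
    using J(1) by simp
  then have "n powr (1 / real J) * (n powr (- 1 / real J) * cut_size E (\<lambda>e. real (u e)) C)
      \<le> n powr (1 / real J) * (4 * \<phi> * (ln n * weight V A))"
    by (rule mult_left_mono) simp
  moreover have "n powr (1 / real J) * n powr (- 1 / real J) = 1"
    using n by (simp flip: powr_add)
  ultimately have "cut_size E (\<lambda>e. real (u e)) C \<le> n powr (1 / real J) * (4 * \<phi> * (ln n * weight V A))"
    by (simp flip: mult.assoc)
  \<comment> \<open>Since \<open>s \<le> 3 * real J\<close>, the exponent \<open>1 / real J\<close>
    is at most \<open>3 / s\<close>; this is the source of the constant 3.\<close>
  also have "\<dots> \<le> n powr (3 / s) * (4 * \<phi> * (ln n * weight V A))"
    using n J s \<phi> W by (intro mult_right_mono powr_mono mult_nonneg_nonneg) (auto simp: field_simps)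
  finally show "\<exists>C. moving_cut E (h * s) C \<and>
      cut_size E (\<lambda>e. real (u e)) C
        \<le> (4 * real (card V) powr (3 / s) * ln (real (card V))) * \<phi> * weight V A \<and>
      expanding V E (cut_len (\<lambda>e. real (l e)) (h * s) C) (\<lambda>e. real (u e)) h s A \<phi>"
    using C(1,3) by (intro exI[of _ C]) (simp add: n_def mult_ac)
qed auto

end
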